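(* Consider Problem A (unobserved actions, common rewards) and suppose every player runs the algorithm \texttt{mQ-learning} described in the context. Then, along every realization of states and rewards, at every step of every episode the $Q$-tables of all $M$ players are identical and all players select the same joint action (which is therefore the joint action actually executed). Moreover, these tables and actions are identical to those of a single centralized agent that runs the same optimistic $Q$-learning updates on the joint-action MDP with action set $\mathcal{A}=\mathcal{A}_1\times\cdots\times\mathcal{A}_M$, with the same lexicographic tie-breaking and seeing the same rewards and states.
   Context: **Model.** A multi-player episodic tabular MDP has $M$ players $P_1,\dots,P_M$, a finite state space $\mathcal{S}$, finite action sets $\mathcal{A}_1,\dots,\mathcal{A}_M$ (one per player), joint action space $\mathcal{A}=\mathcal{A}_1\times\cdots\times\mathcal{A}_M$, horizon $H$, and transition kernels $\mathbb{P}_h(\cdot\mid x,\bm{a})$, $h\in[H]=\{1,\dots,H\}$. There are $K$ episodes of $H$ steps. In each episode all players observe the initial state; at each step $h$ all players observe the current state $x_h$, each player $P_i$ chooses $a_i\in\mathcal{A}_i$, a random reward in $[0,1]$ depending on the joint action is generated, and the next state is drawn from the transition kernel. **Problem A.** The realized reward is common to all players (all observe the same realization), but no player observes the actions of the others. **Lexicographic order.** For $M$-tuples, $\bm{x}<\bm{y}$ iff there is $n$ with $x_i=y_i$ for all $i<n$ and $x_n<y_n$ (each $\mathcal{A}_i$ is totally ordered, in a way known to all players). **Algorithm \texttt{mQ-learning} (run by each player $P_i$ on its own tables).** $\alpha_t=(H+1)/(H+t)$, and $b_t=c\sqrt{H^3\iota/t}$ with constants $c,\iota$ common to all players. Initialize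 $Q_h(i,x,\bm{a})=H$, $N_h(i,x,\bm{a})=0$ for all $(x,\bm{a},h)\in\mathcal{S}\times\mathcal{A}\times[H]$, $V_h(i,x)=H$ for $h\le H$, $V_{H+1}\equiv0$. In each episode $k=1,\dots,K$: receive the initial state; for $h=1,\dots,H$: (1) let $\bm{a}_h$ be the lexicographically smallest element of $\arg\max_{\bm{a}'}Q_h(i,x_h,\bm{a}')$ (the joint action selected by player $i$), and play its $i$-th component; (2) observe the common reward $r_h$ and the next state $x_{h+1}$; (3) increment $N_h(i,x_h,\bm{a}_h)$ by one and call the new value $t$; (4) set $Q_h(i,x_h,\bm{a}_h)\leftarrow(1-\alpha_t)Q_h(i,x_h,\bm{a}_h)+\alpha_t[r_h+V_{h+1}(i,x_{h+1})+b_t]$; (5) set $V_h(i,x_h)\leftarrow\min\{H,\max_{\bm{a}'}Q_h(i,x_h,\bm{a}')\}$. The centralized agent maintains one copy of these tables, performs the same steps, and executes the whole joint action $\bm{a}_h$ itself. *)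

theory Defs
  imports "HOL-Probability.Probability"
begin

(* Players are 1, ..., num_players.  The action sets of different players live in one linearly
   ordered type; its order restricted to actions G i is the total order on the actions of player i. *)
record ('s, 'a) game =
  num_players :: nat
  states :: "'s set"
  actions :: "nat \<Rightarrow> 'a set"
  horizon :: nat
  kernel :: "nat \<Rightarrow> 's \<Rightarrow> (nat \<Rightarrow> 'a) \<Rightarrow> 's pmf"
  reward_law :: "nat \<Rightarrow> 's \<Rightarrow> (nat \<Rightarrow> 'a) \<Rightarrow> real measure"

definition joint_actions :: "('s, 'a) game \<Rightarrow> (nat \<Rightarrow> 'a) set" where
  "joint_actions G = (\<Pi>\<^sub>E i\<in>{1..num_players G}. actions G i)"

definition episodic_mdp :: "('s, 'a) game \<Rightarrow> bool" where
  "episodic_mdp G \<longleftrightarrow>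
     num_players G \<ge> 1 \<and> horizon G \<ge> 1 \<and>
     finite (states G) \<and> states G \<noteq> {} \<and>
     (\<forall>i\<in>{1..num_players G}. finite (actions G i) \<and> actions G i \<noteq> {}) \<and>
     (\<forall>h\<in>{1..horizon G}. \<forall>x\<in>states G. \<forall>a\<in>joint_actions G.
        set_pmf (kernel G h x a) \<subseteq> states G \<and>
        prob_space (reward_law G h x a) \<and>
        sets (reward_law G h x a) = sets (restrict_space borel {0..1}))"

definition lex_less :: "nat \<Rightarrow> (nat \<Rightarrow> 'a::linorder) \<Rightarrow> (nat \<Rightarrow> 'a) \<Rightarrow> bool" where
  "lex_less M a b \<longleftrightarrow> (\<exists>n\<in>{1..M}. (\<forall>i\<in>{1..<n}. a i = b i) \<and> a n < b n)"

record ('s, 'a) tables =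
  Qtab :: "nat \<Rightarrow> 's \<Rightarrow> (nat \<Rightarrow> 'a) \<Rightarrow> real"
  Ntab :: "nat \<Rightarrow> 's \<Rightarrow> (nat \<Rightarrow> 'a) \<Rightarrow> nat"
  Vtab :: "nat \<Rightarrow> 's \<Rightarrow> real"

definition init_tables :: "('s, 'a) game \<Rightarrow> ('s, 'a) tables" where
  "init_tables G =
     \<lparr> Qtab = (\<lambda>h x a. real (horizon G)),
       Ntab = (\<lambda>h x a. 0),
       Vtab = (\<lambda>h x. if h \<le> horizon G then real (horizon G) else 0) \<rparr>"

definition greedy_actions ::
  "('s, 'a) game \<Rightarrow> ('s, 'a) tables \<Rightarrow> nat \<Rightarrow> 's \<Rightarrow> (nat \<Rightarrow> 'a) set" where
  "greedy_actions G T h x = {a. is_arg_max (Qtab T h x) (\<lambda>a. a \<in> joint_actions G) a}"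

definition select ::
  "('s, 'a::linorder) game \<Rightarrow> ('s, 'a) tables \<Rightarrow> nat \<Rightarrow> 's \<Rightarrow> (nat \<Rightarrow> 'a)" where
  "select G T h x =
     (THE a. a \<in> greedy_actions G T h x \<and>
        (\<forall>b\<in>greedy_actions G T h x. b \<noteq> a \<longrightarrow> lex_less (num_players G) a b))"

definition learning_rate :: "nat \<Rightarrow> nat \<Rightarrow> real" where
  "learning_rate H t = (real H + 1) / (real H + real t)"

definition bonus :: "real \<Rightarrow> real \<Rightarrow> nat \<Rightarrow> nat \<Rightarrow> real" where
  "bonus c \<iota> H t = c * sqrt (real H ^ 3 * \<iota> / real t)"

(* Update of one copy of the tables: in state x at step h, the owner of the tables has selected
   the joint action a and observes the reward r and the next state x'. *)
definition q_update ::
  "('s, 'a) game \<Rightarrow> real \<Rightarrow> real \<Rightarrow> nat \<Rightarrow> 's \<Rightarrow> (nat \<Rightarrow> 'a) \<Rightarrow> real \<Rightarrow> 's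
     \<Rightarrow> ('s, 'a) tables \<Rightarrow> ('s, 'a) tables" where
  "q_update G c \<iota> h x a r x' T =
     (let H = horizon G;
          t = Suc (Ntab T h x a);
          \<alpha> = learning_rate H t;
          q = (1 - \<alpha>) * Qtab T h x a + \<alpha> * (r + Vtab T (h + 1) x' + bonus c \<iota> H t);
          N' = (Ntab T)(h := (Ntab T h)(x := (Ntab T h x)(a := t)));
          Q' = (Qtab T)(h := (Qtab T h)(x := (Qtab T h x)(a := q)));
          v = min (real H) (Max (Q' h x ` joint_actions G))
      in \<lparr> Qtab = Q', Ntab = N', Vtab = (Vtab T)(h := (Vtab T h)(x := v)) \<rparr>)"

(* Every player has a copy of the tables and, not observing the actions of the others, updates the
   entry of the joint action selected from that copy, whatever joint action was executed. *)
definition players_step ::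
  "('s, 'a::linorder) game \<Rightarrow> real \<Rightarrow> real \<Rightarrow> nat \<Rightarrow> 's \<Rightarrow> real \<Rightarrow> 's
     \<Rightarrow> (nat \<Rightarrow> ('s, 'a) tables) \<Rightarrow> (nat \<Rightarrow> ('s, 'a) tables)" where
  "players_step G c \<iota> h x r x' T = (\<lambda>i. q_update G c \<iota> h x (select G (T i) h x) r x' (T i))"

definition central_step ::
  "('s, 'a::linorder) game \<Rightarrow> real \<Rightarrow> real \<Rightarrow> nat \<Rightarrow> 's \<Rightarrow> real \<Rightarrow> 's
     \<Rightarrow> ('s, 'a) tables \<Rightarrow> ('s, 'a) tables" where
  "central_step G c \<iota> h x r x' T = q_update G c \<iota> h x (select G T h x) r x' T"

(* State of a learner after the first n steps of an episode with states xs 1, xs 2, ... and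
   rewards rs 1, rs 2, ... that starts in learner state T. *)
primrec after_steps ::
  "(nat \<Rightarrow> 's \<Rightarrow> real \<Rightarrow> 's \<Rightarrow> 't \<Rightarrow> 't) \<Rightarrow> (nat \<Rightarrow> 's) \<Rightarrow> (nat \<Rightarrow> real) \<Rightarrow> 't \<Rightarrow> nat \<Rightarrow> 't" where
  "after_steps stp xs rs T 0 = T"
| "after_steps stp xs rs T (Suc n) =
     stp (Suc n) (xs (Suc n)) (rs (Suc n)) (xs (Suc (Suc n))) (after_steps stp xs rs T n)"

primrec after_episodes ::
  "(nat \<Rightarrow> 's \<Rightarrow> real \<Rightarrow> 's \<Rightarrow> 't \<Rightarrow> 't) \<Rightarrow> nat \<Rightarrow> (nat \<Rightarrow> nat \<Rightarrow> 's) \<Rightarrow> (nat \<Rightarrow> nat \<Rightarrow> real)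
     \<Rightarrow> 't \<Rightarrow> nat \<Rightarrow> 't" where
  "after_episodes stp H x r T 0 = T"
| "after_episodes stp H x r T (Suc k) =
     after_steps stp (x (Suc k)) (r (Suc k)) (after_episodes stp H x r T k) H"

(* x k h and r k h are the state and the reward at step h of episode k (both counted from 1).
   The value for (k, h) is the learner state just before step h of episode k; h = H + 1 gives the
   state after the last step of the episode. *)
definition before_step ::
  "(nat \<Rightarrow> 's \<Rightarrow> real \<Rightarrow> 's \<Rightarrow> 't \<Rightarrow> 't) \<Rightarrow> nat \<Rightarrow> (nat \<Rightarrow> nat \<Rightarrow> 's) \<Rightarrow> (nat \<Rightarrow> nat \<Rightarrow> real)
     \<Rightarrow> 't \<Rightarrow> nat \<Rightarrow> nat \<Rightarrow> 't" where
  "before_step stp H x r T k h =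
     after_steps stp (x k) (r k) (after_episodes stp H x r T (k - 1)) (h - 1)"

definition player_tables ::
  "('s, 'a::linorder) game \<Rightarrow> real \<Rightarrow> real \<Rightarrow> (nat \<Rightarrow> nat \<Rightarrow> 's) \<Rightarrow> (nat \<Rightarrow> nat \<Rightarrow> real)
     \<Rightarrow> nat \<Rightarrow> nat \<Rightarrow> nat \<Rightarrow> ('s, 'a) tables" where
  "player_tables G c \<iota> x r k h i =
     before_step (players_step G c \<iota>) (horizon G) x r (\<lambda>i. init_tables G) k h i"

definition player_selected ::
  "('s, 'a::linorder) game \<Rightarrow> real \<Rightarrow> real \<Rightarrow> (nat \<Rightarrow> nat \<Rightarrow> 's) \<Rightarrow> (nat \<Rightarrow> nat \<Rightarrow> real)
     \<Rightarrow> nat \<Rightarrow> nat \<Rightarrow> nat \<Rightarrow> (nat \<Rightarrow> 'a)" where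
  "player_selected G c \<iota> x r k h i = select G (player_tables G c \<iota> x r k h i) h (x k h)"

definition executed ::
  "('s, 'a::linorder) game \<Rightarrow> real \<Rightarrow> real \<Rightarrow> (nat \<Rightarrow> nat \<Rightarrow> 's) \<Rightarrow> (nat \<Rightarrow> nat \<Rightarrow> real)
     \<Rightarrow> nat \<Rightarrow> nat \<Rightarrow> (nat \<Rightarrow> 'a)" where
  "executed G c \<iota> x r k h = (\<lambda>i\<in>{1..num_players G}. player_selected G c \<iota> x r k h i i)"

definition central_tables ::
  "('s, 'a::linorder) game \<Rightarrow> real \<Rightarrow> real \<Rightarrow> (nat \<Rightarrow> nat \<Rightarrow> 's) \<Rightarrow> (nat \<Rightarrow> nat \<Rightarrow> real)
     \<Rightarrow> nat \<Rightarrow> nat \<Rightarrow> ('s, 'a) tables" where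
  "central_tables G c \<iota> x r k h =
     before_step (central_step G c \<iota>) (horizon G) x r (init_tables G) k h"

definition central_action ::
  "('s, 'a::linorder) game \<Rightarrow> real \<Rightarrow> real \<Rightarrow> (nat \<Rightarrow> nat \<Rightarrow> 's) \<Rightarrow> (nat \<Rightarrow> nat \<Rightarrow> real)
     \<Rightarrow> nat \<Rightarrow> nat \<Rightarrow> (nat \<Rightarrow> 'a)" where
  "central_action G c \<iota> x r k h = select G (central_tables G c \<iota> x r k h) h (x k h)"

(* The states x and rewards r are a possible outcome of K episodes in which the joint action
   act k h is executed at step h of episode k.  Initial states are arbitrary; every reward value
   in [0,1] is admitted, so that no null set of rewards is excluded. *)
definition realization ::
  "('s, 'a) game \<Rightarrow> nat \<Rightarrow> (nat \<Rightarrow> nat \<Rightarrow> nat \<Rightarrow> 'a) \<Rightarrow> (nat \<Rightarrow> nat \<Rightarrow> 's)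
     \<Rightarrow> (nat \<Rightarrow> nat \<Rightarrow> real) \<Rightarrow> bool" where
  "realization G K act x r \<longleftrightarrow>
     (\<forall>k\<in>{1..K}. x k 1 \<in> states G \<and>
        (\<forall>h\<in>{1..horizon G}.
           r k h \<in> space (reward_law G h (x k h) (act k h)) \<and>
           x k (h + 1) \<in> set_pmf (kernel G h (x k h) (act k h))))"

end

(* Since player_tables is defined from the states and rewards alone, and every player starts from the
   same tables, it suffices that one step maps the constant family of tables to a constant family.
   The only other point is that the lexicographic tie-breaking returns a joint action, so that
   executing it componentwise reproduces the function the players selected. *)
theory Submission imports Defs begin

text \<open>Of two witnessing positions, the smaller lies in the range where the other witness
  forces agreement. Asymmetry is what makes the least greedy action unique.\<close>

lemma asymp_lex_less: "asymp (lex_less M)"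
proof (rule asympI)
  fix a b :: "nat \<Rightarrow> 'a::linorder"
  assume "lex_less M a b"
  then obtain n where n: "n \<in> {1..M}" "\<forall>i\<in>{1..<n}. a i = b i" "a n < b n"
    unfolding lex_less_def by blast
  show "\<not> lex_less M b a"
  proof
    assume "lex_less M b a"
    then obtain m where m: "m \<in> {1..M}" "\<forall>i\<in>{1..<m}. b i = a i" "b m < a m"
      unfolding lex_less_def by blast
    show False
    proof (cases n m rule: linorder_cases)
      case less
      then have "b n = a n" using n(1) m(2) by simp
      then show False using n(3) by simp
    next
      case equal
      then show False using n(3) m(3) by simp
    next
      case greater
      then have "a m = b m" using m(1) n(2) by simp
      then show False using m(3) by simp
    qed
  qed
qed

lemma transp_lex_less: "transp (lex_less M)"
proof (rule transpI)
  fix a b c :: "nat \<Rightarrow> 'a::linorder"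
  assume "lex_less M a b" and "lex_less M b c"
  then obtain n m where n: "n \<in> {1..M}" "\<forall>i\<in>{1..<n}. a i = b i" "a n < b n"
    and m: "m \<in> {1..M}" "\<forall>i\<in>{1..<m}. b i = c i" "b m < c m"
    unfolding lex_less_def by blast
  \<comment> \<open>The witness for \<open>a\<close> against \<open>c\<close> is the earlier of the
    two positions: there one comparison is strict, and the other is strict or an equality.\<close>
  have "\<forall>i\<in>{1..<min n m}. a i = c i"
    using n(2) m(2) by simp
  moreover have "a (min n m) < c (min n m)"
  proof (cases n m rule: linorder_cases)
    case less
    then have "b n = c n" using n(1) m(2) by simp
    then show ?thesis using n(3) less by (simp add: min_def)
  next
    case equal
    then show ?thesis using n(3) m(3) by simp
  next
    case greater
    then have "a m = b m" using m(1) n(2) by simp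
    then show ?thesis using m(3) greater by (simp add: min_def)
  qed
  moreover have "min n m \<in> {1..M}"
    using n(1) m(1) by (simp add: min_def)
  ultimately show "lex_less M a c"
    unfolding lex_less_def by blast
qed

text \<open>\<open>lex_less\<close> inspects only the entries in \<open>{1..M}\<close>, so functions
  that differ only elsewhere are incomparable. Extensionality rules such pairs out, and the first
  difference decides.\<close>

lemma totalp_on_lex_less: "totalp_on (Pi\<^sub>E {1..M} A) (lex_less M)"
proof (rule totalp_onI)
  fix a b :: "nat \<Rightarrow> 'a::linorder"
  assume a: "a \<in> Pi\<^sub>E {1..M} A" and b: "b \<in> Pi\<^sub>E {1..M} A" and "a \<noteq> b"
  define n where "n = (LEAST i. a i \<noteq> b i)"
  from \<open>a \<noteq> b\<close> obtain j where "a j \<noteq> b j" by blast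
  then have n: "a n \<noteq> b n"
    unfolding n_def by (rule LeastI)
  have below: "a i = b i" if "i < n" for i
    using not_less_Least[of i "\<lambda>i. a i \<noteq> b i"] that unfolding n_def by blast
  \<comment> \<open>The \<open>LEAST\<close> ranges over all naturals, including 0; at an index
    outside \<open>{1..M}\<close> both functions take the value \<open>undefined\<close>.\<close>
  have nM: "n \<in> {1..M}"
  proof (rule ccontr)
    assume "n \<notin> {1..M}"
    with n show False
      using PiE_arb[OF a] PiE_arb[OF b] by simp
  qed
  from n consider "a n < b n" | "b n < a n" by fastforce
  then show "lex_less M a b \<or> lex_less M b a"
  proof cases
    case 1
    have "lex_less M a b"
      unfolding lex_less_def using nM 1 below by (intro bexI[of _ n]) auto
    then show ?thesis ..
  next
    case 2
    have "lex_less M b a"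
      unfolding lex_less_def using nM 2 below by (intro bexI[of _ n]) auto
    then show ?thesis ..
  qed
qed

lemma greedy_actions_nonempty:
  assumes "finite (joint_actions G)" and "joint_actions G \<noteq> {}"
  shows "greedy_actions G T h x \<noteq> {}"
proof -
  let ?S = "Qtab T h x ` joint_actions G"
  have S: "finite ?S" "?S \<noteq> {}"
    using assms by simp_all
  then obtain a where "a \<in> joint_actions G" "Qtab T h x a = Max ?S"
    using Max_in by (metis imageE)
  then have "a \<in> greedy_actions G T h x"
    using S(1) by (auto simp: greedy_actions_def is_arg_max_linorder)
  then show ?thesis by blast
qed

text \<open>Because \<open>select\<close> is a \<open>THE\<close>, membership requires existence and
  uniqueness of its value. A finite nonempty set on which the order is total and transitive has a
  least element.\<close>

lemma select_in_joint_actions: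
  fixes G :: "('s, 'a::linorder) game"
  assumes "episodic_mdp G"
  shows "select G T h x \<in> joint_actions G"
proof -
  let ?M = "num_players G" and ?A = "greedy_actions G T h x"
  let ?P = "\<lambda>a. a \<in> ?A \<and> (\<forall>b\<in>?A. b \<noteq> a \<longrightarrow> lex_less ?M a b)"
  have J: "finite (joint_actions G)" "joint_actions G \<noteq> {}"
    using assms by (auto simp: episodic_mdp_def joint_actions_def PiE_eq_empty_iff intro!: finite_PiE)
  have sub: "?A \<subseteq> joint_actions G"
    by (auto simp: greedy_actions_def is_arg_max_def)
  have "totalp_on ?A (lex_less ?M)"
    using totalp_on_lex_less sub unfolding joint_actions_def by (rule totalp_on_subset)
  moreover have "transp_on ?A (lex_less ?M)"
    using transp_lex_less subset_UNIV by (rule transp_on_subset)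
  ultimately obtain a where a: "?P a"
    using Finite_Set.bex_least_element[OF finite_subset[OF sub J(1)] greedy_actions_nonempty[OF J]]
    by blast
  \<comment> \<open>Two distinct least elements would each be smaller than the other.\<close>
  have "b = a" if "?P b" for b
    using a that asympD[OF asymp_lex_less] by metis
  with a have "select G T h x = a"
    unfolding select_def by (rule the_equality)
  then show ?thesis
    using a sub by blast
qed

text \<open>The starting tables \<open>T\<close> are arbitrary, so that the result applies again at
  the start of every later episode.\<close>

lemma after_steps_players:
  "after_steps (players_step G c \<iota>) xs rs (\<lambda>i. T) n =
     (\<lambda>i. after_steps (central_step G c \<iota>) xs rs T n)"
  by (induction n) (simp_all add: players_step_def central_step_def)

lemma after_episodes_players:
  "after_episodes (players_step G c \<iota>) H x r (\<lambda>i. T) k =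
     (\<lambda>i. after_episodes (central_step G c \<iota>) H x r T k)"
  by (induction k) (simp_all add: after_steps_players)

lemma player_tables_eq_central_tables:
  "player_tables G c \<iota> x r k h i = central_tables G c \<iota> x r k h"
  by (simp add: player_tables_def central_tables_def before_step_def
      after_episodes_players after_steps_players)

lemma player_selected_eq_central_action:
  "player_selected G c \<iota> x r k h i = central_action G c \<iota> x r k h"
  by (simp add: player_selected_def central_action_def player_tables_eq_central_tables)

text \<open>Once all selections agree, \<open>executed\<close> is the restriction of the central
  action to the players, and restricting an extensional function changes nothing. The equality is
  one of functions, so that it can rewrite the argument of \<open>realization\<close>.\<close>

lemma executed_eq_central_action:
  assumes "episodic_mdp G"
  shows "executed G c \<iota> x r = central_action G c \<iota> x r"
proof (intro ext)
  fix k h i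
  have "central_action G c \<iota> x r k h \<in> joint_actions G"
    unfolding central_action_def by (rule select_in_joint_actions[OF assms])
  then show "executed G c \<iota> x r k h i = central_action G c \<iota> x r k h i"
    unfolding executed_def player_selected_eq_central_action joint_actions_def
    by (simp add: PiE_restrict)
qed

theorem mainTheorem4:
  fixes G :: "('s, 'a::linorder) game"
    and K :: nat and c \<iota> :: real
    and x :: "nat \<Rightarrow> nat \<Rightarrow> 's" and r :: "nat \<Rightarrow> nat \<Rightarrow> real"
  assumes "episodic_mdp G"
    and "realization G K (executed G c \<iota> x r) x r"
  shows "(\<forall>k\<in>{1..K}. \<forall>h\<in>{1..horizon G + 1}. \<forall>i\<in>{1..num_players G}.
            \<forall>h'\<in>{1..horizon G}. \<forall>s\<in>states G. \<forall>a\<in>joint_actions G.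
              (\<forall>j\<in>{1..num_players G}.
                 Qtab (player_tables G c \<iota> x r k h i) h' s a
                   = Qtab (player_tables G c \<iota> x r k h j) h' s a) \<and>
              Qtab (player_tables G c \<iota> x r k h i) h' s a
                = Qtab (central_tables G c \<iota> x r k h) h' s a)
       \<and> (\<forall>k\<in>{1..K}. \<forall>h\<in>{1..horizon G}. \<forall>i\<in>{1..num_players G}.
              (\<forall>j\<in>{1..num_players G}.
                 player_selected G c \<iota> x r k h i = player_selected G c \<iota> x r k h j) \<and>
              player_selected G c \<iota> x r k h i = executed G c \<iota> x r k h \<and>
              player_selected G c \<iota> x r k h i = central_action G c \<iota> x r k h)
       \<and> realization G K (central_action G c \<iota> x r) x r"
  \<comment> \<open>After rewriting, the table and action equations are reflexive, and the assumed
    realization becomes the last conjunct.\<close>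
  using assms(2)
  by (simp add: player_tables_eq_central_tables player_selected_eq_central_action
      executed_eq_central_action[OF assms(1)])

end
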